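(* Let $f:\mathbb{R}^d\to\mathbb{R}$ be a Lipschitz function. For any $\rho,\nu\ge0$ and any $\mathbf{x}\in\mathbb{R}^d$, $$\partial_{\nu}f_{\rho}(\mathbf{x})\subseteq\partial_{\rho+\nu}f(\mathbf{x}).$$ Hence, if $\mathbf{x}$ is a $(\nu,\epsilon)$-stationary point of $f_\rho$, then it is a $(\rho+\nu,\epsilon)$-stationary point of $f$. In particular, as long as $\rho+\nu\le\delta$, it is a $(\delta,\epsilon)$-stationary point of $f$.
   Context: $\|\cdot\|$ is the Euclidean norm and $\mathbb{B}(\mathbf{x},\delta)$ is the closed Euclidean ball of radius $\delta$ around $\mathbf{x}$ in $\mathbb{R}^d$. For a Lipschitz function $f:\mathbb{R}^d\to\mathbb{R}$ and $\rho\ge0$, its uniform smoothing is $f_\rho(\mathbf{x}):=\mathbb{E}_{\mathbf{z}\sim\mathrm{Unif}(\mathbb{B}(\mathbf{0},1))}[f(\mathbf{x}+\rho\mathbf{z})]$ (which is again Lipschitz). The Clarke subdifferential of a Lipschitz function $h$ is $\partial h(\mathbf{x}):=\mathrm{conv}\{\mathbf{g}:\mathbf{g}=\lim_{n\to\infty}\nabla h(\mathbf{x}_n),\ \mathbf{x}_n\to\mathbf{x}\}$, over sequences of points $\mathbf{x}_n$ at which $h$ is differentiable. For $\delta\ge0$ the Goldstein $\delta$-subdifferential is $\partial_\delta h(\mathbf{x}):=\mathrm{conv}\left(\bigcup_{\mathbf{y}\in\mathbb{B}(\mathbf{x},\delta)}\partial h(\mathbf{y})\right)$, and $\bar{\partial}_\delta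 h(\mathbf{x}):=\arg\min_{\mathbf{g}\in\partial_\delta h(\mathbf{x})}\|\mathbf{g}\|$ is its minimum-norm element. A point $\mathbf{x}$ is a $(\delta,\epsilon)$-stationary point of $h$ if $\|\bar{\partial}_\delta h(\mathbf{x})\|\le\epsilon$. *)

theory Defs
  imports "HOL-Analysis.Analysis"
begin

definition uniform_smoothing ::
    "('a::euclidean_space \<Rightarrow> real) \<Rightarrow> real \<Rightarrow> 'a \<Rightarrow> real" where
  "uniform_smoothing f \<rho> x =
     (\<integral>z. f (x + \<rho> *\<^sub>R z) \<partial>uniform_measure lborel (cball 0 1))"

text \<open>Membership of \<open>X n\<close> in the set of points of (Frechet) differentiability is
  expressed by \<open>GDERIV h (X n) :> G n\<close>, where \<open>G n\<close> is then the gradient at \<open>X n\<close>.\<close>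

definition clarke_subdifferential ::
    "('a::euclidean_space \<Rightarrow> real) \<Rightarrow> 'a \<Rightarrow> 'a set" where
  "clarke_subdifferential h x =
     convex hull {g. \<exists>X G. (\<forall>n::nat. GDERIV h (X n) :> G n) \<and>
                            X \<longlonglongrightarrow> x \<and> G \<longlonglongrightarrow> g}"

definition goldstein_subdifferential ::
    "real \<Rightarrow> ('a::euclidean_space \<Rightarrow> real) \<Rightarrow> 'a \<Rightarrow> 'a set" where
  "goldstein_subdifferential \<delta> h x =
     convex hull (\<Union>y\<in>cball x \<delta>. clarke_subdifferential h y)"

text \<open>For Lipschitz \<open>h\<close> and \<open>\<delta> \<ge> 0\<close> the Goldstein subdifferential is nonempty, compact
  and convex, so that the minimizer selected here exists and is unique; in other cases the
  value need not be meaningful.\<close>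

definition goldstein_min_norm ::
    "real \<Rightarrow> ('a::euclidean_space \<Rightarrow> real) \<Rightarrow> 'a \<Rightarrow> 'a" where
  "goldstein_min_norm \<delta> h x =
     (ARG_MIN norm g. g \<in> goldstein_subdifferential \<delta> h x)"

definition goldstein_stationary ::
    "real \<Rightarrow> real \<Rightarrow> ('a::euclidean_space \<Rightarrow> real) \<Rightarrow> 'a \<Rightarrow> bool" where
  "goldstein_stationary \<delta> \<epsilon> h x \<longleftrightarrow> norm (goldstein_min_norm \<delta> h x) \<le> \<epsilon>"

end

theory Submission
  imports Defs "HOL-Probability.Probability_Measure"
begin

text \<open>By Rademacher's theorem and dominated convergence, a gradient of \<open>f\<^sub>\<rho>\<close> at \<open>y\<close> is an average of
  gradients of \<open>f\<close> over the ball of radius \<open>\<rho>\<close> around \<open>y\<close>. The set \<open>\<partial>\<^sub>\<rho>\<^sub>+\<^sub>\<nu> f(x)\<close> is the convex hull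
  of a compact section of the closure of the graph of the gradient, so a point outside it is
  strictly separated from it, and the separation persists for all gradients of \<open>f\<close> in a slightly
  larger ball; hence it persists for the nearby gradients of \<open>f\<^sub>\<rho>\<close>. Stationarity passes from
  the smaller set to the larger one.

  Rademacher's theorem: one-sided directional derivatives exist almost everywhere along lines, hence
  almost everywhere by Fubini. Their integrals over boxes are additive in the direction, hence so
  are they almost everywhere by Lebesgue differentiation; linearity on a countable dense
  set of directions and the Lipschitz bound give differentiability.\<close>

section \<open>Rademacher's theorem\<close>

text \<open>\<open>F s = h s + (L + 1) s\<close> is an increasing bi-Lipschitz bijection, so its inverse pushes Lebesgue
  measure forward to an absolutely continuous measure; its density is the derivative of \<open>F\<close>
  by Lebesgue differentiation.\<close>

lemma AE_lipschitz_right_derivative: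
  fixes h :: "real \<Rightarrow> real"
  assumes "L-lipschitz_on UNIV h"
  shows "AE s in lborel. \<exists>l. ((\<lambda>t. (h (s + t) - h s) / t) \<longlongrightarrow> l) (at_right 0)"
proof -
  have h: "\<bar>h b - h a\<bar> \<le> L * (b - a)" if "a \<le> b" for a b
    using lipschitz_onD[OF assms, of b a] that by (auto simp: dist_real_def)
  \<comment> \<open>The slope \<open>L + 1\<close> exceeds by 1 the fastest possible decrease of
    \<open>h\<close>, so \<open>F\<close> never contracts distances.\<close>
  define F where "F s = h s + (L + 1) * s" for s
  have F_lower: "b - a \<le> F b - F a" and F_upper: "F b - F a \<le> (2 * L + 1) * (b - a)"
    if "a \<le> b" for a b
    using h[OF that] by (auto simp: F_def algebra_simps)
  have mono: "strict_mono F"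
    proof (rule strict_monoI)
    show "F a < F b" if "a < b" for a b
      using F_lower[of a b] that by linarith
  qed
  have cont: "continuous_on S F" for S
    unfolding F_def using lipschitz_on_continuous_on[OF assms]
    by (intro continuous_intros) (auto intro: continuous_on_subset)
  have "\<exists>x. F x = y" for y
  proof -
    \<comment> \<open>Since \<open>F\<close> grows at rate at least 1, moving from 0 by
      \<open>y - F 0\<close> reaches or overshoots the value \<open>y\<close>; \<open>min\<close>
      and \<open>max\<close> with 0 cover both signs.\<close>
    define a b where "a = min 0 (y - F 0)" and "b = max 0 (y - F 0)"
    have "a \<le> b" "F a \<le> y" "y \<le> F b"
      using F_lower[of a 0] F_lower[of 0 b] by (auto simp: a_def b_def split: if_splits)
    then show ?thesis
      using IVT'[of F a y b, OF _ _ _ cont] \<open>a \<le> b\<close> by blast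
  qed
  then have "bij F"
    using strict_mono_imp_inj_on[OF mono] by (metis bijI surjI)
  define G where "G = inv F"
  have FG [simp]: "F (G y) = y" "G (F s) = s" for y s
    using \<open>bij F\<close> by (auto simp: G_def bij_is_surj bij_is_inj surj_f_inv_f)
  have F_le: "F a \<le> F b \<longleftrightarrow> a \<le> b" for a b
    using mono by (simp add: strict_mono_less_eq)
  have "mono G"
    by (rule monoI) (metis F_le FG(1))
  then have G_meas [measurable]: "G \<in> borel_measurable borel"
    by (rule borel_measurable_mono)
  define \<mu> where "\<mu> = distr lborel borel G"
  have \<mu>: "emeasure \<mu> A = emeasure lborel (G -` A)" if "A \<in> sets borel" for A
    using that by (simp add: \<mu>_def emeasure_distr)
  have G_vimage: "G -` A = F ` A" for A
    using FG by (metis (no_types, lifting) bij_vimage_eq_inv_image G_def \<open>bij F\<close> bij_imp_bij_inv inv_inv_eq)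
  \<comment> \<open>The preimage of a set under \<open>G\<close> is its image under the Lipschitz
    map \<open>F\<close>, and Lipschitz images of null sets are null.\<close>
  have "absolutely_continuous lborel \<mu>"
    unfolding absolutely_continuous_def
  proof
    fix A assume A: "A \<in> null_sets (lborel :: real measure)"
    then have A': "A \<in> sets borel" and "negligible A"
      by (auto simp: negligible_iff_null_sets null_sets_completionI)
    have "negligible (F ` A)"
    proof (rule negligible_locally_Lipschitz_image)
      show "\<exists>T B. open T \<and> x \<in> T \<and> (\<forall>y\<in>A \<inter> T. norm (F y - F x) \<le> B * norm (y - x))" for x
      proof (intro exI[of _ UNIV] exI[of _ "2 * L + 1"] conjI ballI)
        fix y
        show "norm (F y - F x) \<le> (2 * L + 1) * norm (y - x)"
          using F_upper[of x y] F_upper[of y x] F_le[of x y] F_le[of y x]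
          by (cases "x \<le> y") (auto simp: algebra_simps)
      qed auto
    qed (use \<open>negligible A\<close> in auto)
    then have "F ` A \<in> null_sets lborel"
      using measurable_sets[OF G_meas A'] by (simp add: G_vimage negligible_iff_null_sets null_sets_completion_iff)
    then show "A \<in> null_sets \<mu>"
      using A' by (auto simp: null_sets_def \<mu> G_vimage) (simp add: \<mu>_def)
  qed
  then obtain g where g [measurable]: "g \<in> borel_measurable lborel" and dens: "density lborel g = \<mu>"
    using sigma_finite_measure.Radon_Nikodym[OF sigma_finite_lborel, of \<mu>] by (auto simp: \<mu>_def)
  \<comment> \<open>\<open>enn2real\<close> sends infinity to 0. This changes no integral over a
    bounded interval: those integrals of \<open>g\<close> are finite, so \<open>g\<close> is
    infinite only on a null set there.\<close>
  define g' where "g' s = enn2real (g s)" for s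
  have [measurable]: "g' \<in> borel_measurable borel"
    using g unfolding g'_def by simp
  have int: "(g' has_integral (F b - F a)) {a..b}" if "a \<le> b" for a b
  proof -
    have "G -` {a..b} = {F a..F b}"
      using F_le[of a "G _"] F_le[of "G _" b] by auto
    then have eq: "(\<integral>\<^sup>+s. g s * indicator {a..b} s \<partial>lborel) = ennreal (F b - F a)"
      using \<mu>[of "{a..b}"] that F_le[of a b] by (simp add: dens[symmetric] emeasure_density)
    then have "AE s in lborel. g s * indicator {a..b} s \<noteq> \<infinity>"
      by (intro nn_integral_PInf_AE) auto
    then have "(\<integral>\<^sup>+s. ennreal (g' s * indicator {a..b} s) \<partial>lborel)
        = (\<integral>\<^sup>+s. g s * indicator {a..b} s \<partial>lborel)"
      by (intro nn_integral_cong_AE) (auto simp: g'_def indicator_def less_top)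
    then have "((\<lambda>s. g' s * indicator {a..b} s) has_integral (F b - F a)) UNIV"
      using eq that F_le[of a b] by (intro nn_integral_has_integral) (auto simp: g'_def)
    then have "((\<lambda>s. if s \<in> {a..b} then g' s else 0) has_integral (F b - F a)) UNIV"
      by (rule has_integral_eq[rotated]) auto
    then show ?thesis
      by (simp only: has_integral_restrict_UNIV)
  qed
  have "g' integrable_on cbox a b" for a b
    using int[of a b] by (cases "a \<le> b") auto
  \<comment> \<open>Lebesgue differentiation: off a null set, the averages of \<open>g'\<close> over
    \<open>[x, x + t]\<close> tend to \<open>g' x\<close>. By \<open>int\<close> these averages are
    difference quotients of \<open>F\<close>.\<close>
  then obtain N where N: "negligible N"
    "\<And>x e. \<lbrakk>x \<notin> N; 0 < e\<rbrakk> \<Longrightarrow> \<exists>d>0. \<forall>t. 0 < t \<and> t < d \<longrightarrow>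
       norm (integral (cbox x (x + t *\<^sub>R One)) g' /\<^sub>R t ^ DIM(real) - g' x) < e"
    by (rule integrable_ccontinuous_explicit) blast
  have "\<exists>l. ((\<lambda>t. (h (s + t) - h s) / t) \<longlongrightarrow> l) (at_right 0)" if "s \<notin> N" for s
  proof -
    have "((\<lambda>t. (F (s + t) - F s) / t) \<longlongrightarrow> g' s) (at_right 0)"
      unfolding tendsto_iff eventually_at_right_field
    proof (intro allI impI)
      fix e :: real assume "e > 0"
      from N(2)[OF that this] obtain d where d: "d > 0" "\<And>t. 0 < t \<Longrightarrow> t < d \<Longrightarrow>
          norm (integral (cbox s (s + t *\<^sub>R One)) g' /\<^sub>R t ^ DIM(real) - g' s) < e"
        by blast
      have "dist ((F (s + t) - F s) / t) (g' s) < e" if "0 < t" "t < d" for t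
        using d(2)[OF that] integral_unique[OF int[of s "s + t"]] that
        by (simp add: dist_real_def divide_inverse mult.commute)
      then show "\<exists>b>0. \<forall>t>0. t < b \<longrightarrow> dist ((F (s + t) - F s) / t) (g' s) < e"
        using d(1) by blast
    qed
    then have lim: "((\<lambda>t. (F (s + t) - F s) / t - (L + 1)) \<longlongrightarrow> g' s - (L + 1)) (at_right 0)"
      by (intro tendsto_intros)
    have "\<forall>\<^sub>F t in at_right 0. (F (s + t) - F s) / t - (L + 1) = (h (s + t) - h s) / t"
      using eventually_at_right_less[of 0] by eventually_elim (auto simp: F_def field_simps)
    with lim show ?thesis
      by (intro exI) (rule Lim_transform_eventually)
  qed
  then have "AE s in lebesgue. \<exists>l. ((\<lambda>t. (h (s + t) - h s) / t) \<longlongrightarrow> l) (at_right 0)"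
    using N(1) unfolding eventually_ae_filter_negligible by blast
  then show ?thesis
    by (simp add: AE_completion_iff)
qed

section \<open>One-sided directional derivatives almost everywhere\<close>

text \<open>The Cauchy criterion eliminates the unknown limit and leaves countable outer quantifiers
  over \<open>k\<close> and \<open>m\<close>, so that the set of points where a limit exists can be
  shown to be Borel.\<close>

lemma ex_tendsto_at_right_iff_Cauchy:
  fixes q :: "real \<Rightarrow> real"
  shows "(\<exists>l. (q \<longlongrightarrow> l) (at_right 0)) \<longleftrightarrow>
    (\<forall>k. \<exists>m. \<forall>s\<in>{0<..<inverse (real (Suc m))}. \<forall>t\<in>{0<..<inverse (real (Suc m))}.
       \<bar>q s - q t\<bar> \<le> inverse (real (Suc k)))" (is "?L \<longleftrightarrow> ?R")
proof
  assume ?L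
  then obtain l where l: "(q \<longlongrightarrow> l) (at_right 0)" ..
  show ?R
  proof
    fix k
    have "\<forall>\<^sub>F t in at_right 0. dist (q t) l < inverse (real (Suc k)) / 2"
      by (rule tendstoD[OF l]) simp
    then obtain b where b: "b > 0" "\<And>t. 0 < t \<Longrightarrow> t < b \<Longrightarrow> dist (q t) l < inverse (real (Suc k)) / 2"
      by (auto simp: eventually_at_right_field)
    obtain m where m: "inverse (real (Suc m)) < b"
      using reals_Archimedean[OF b(1)] by blast
    have "\<bar>q s - q t\<bar> \<le> inverse (real (Suc k))"
      if "s \<in> {0<..<inverse (real (Suc m))}" "t \<in> {0<..<inverse (real (Suc m))}" for s t
    proof -
      have "dist (q s) l < inverse (real (Suc k)) / 2" "dist (q t) l < inverse (real (Suc k)) / 2"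
        using b(2)[OF _ order.strict_trans[OF _ m]] that by (simp_all only: greaterThanLessThan_iff)
      then show ?thesis
        unfolding dist_real_def by linarith
    qed
    then show "\<exists>m. \<forall>s\<in>{0<..<inverse (real (Suc m))}. \<forall>t\<in>{0<..<inverse (real (Suc m))}.
       \<bar>q s - q t\<bar> \<le> inverse (real (Suc k))"
      by blast
  qed
next
  assume R: ?R
  have "cauchy_filter (filtermap q (at_right 0))"
    unfolding cauchy_filter_metric_filtermap
  proof (intro allI impI)
    fix e :: real assume "e > 0"
    then obtain k where k: "inverse (real (Suc k)) < e"
      using reals_Archimedean by blast
    obtain m where m: "\<And>s t. s \<in> {0<..<inverse (real (Suc m))} \<Longrightarrow> t \<in> {0<..<inverse (real (Suc m))} \<Longrightarrow>
        \<bar>q s - q t\<bar> \<le> inverse (real (Suc k))"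
      using R by blast
    define P where "P t \<longleftrightarrow> t \<in> {0<..<inverse (real (Suc m))}" for t
    have "eventually P (at_right 0)"
      unfolding eventually_at_right_field P_def
      by (rule exI[of _ "inverse (real (Suc m))"]) auto
    moreover have "dist (q s) (q t) < e" if "P s \<and> P t" for s t
      using m[of s t] that k unfolding P_def dist_real_def by linarith
    ultimately show "\<exists>P. eventually P (at_right 0) \<and> (\<forall>x y. P x \<and> P y \<longrightarrow> dist (q x) (q y) < e)"
      by blast
  qed
  moreover have "complete (UNIV :: real set)"
    by (simp add: complete_UNIV)
  ultimately show ?L
    using cauchy_filter_complete_converges[of "filtermap q (at_right 0)" UNIV]
    by (auto simp: filterlim_def filtermap_bot_iff)
qed

definition dquot :: "('a::euclidean_space \<Rightarrow> real) \<Rightarrow> 'a \<Rightarrow> real \<Rightarrow> 'a \<Rightarrow> real" where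
  "dquot f v t x = (f (x + t *\<^sub>R v) - f x) / t"

lemma dquot_bound:
  fixes f :: "'a::euclidean_space \<Rightarrow> real"
  assumes "L-lipschitz_on UNIV f" "t > 0"
  shows "\<bar>dquot f v t x\<bar> \<le> L * norm v"
  using lipschitz_onD[OF assms(1), of "x + t *\<^sub>R v" x] assms(2)
  by (auto simp: dquot_def dist_norm field_simps)

lemma continuous_on_dquot:
  fixes f :: "'a::euclidean_space \<Rightarrow> real"
  assumes "continuous_on UNIV f"
  shows "continuous_on UNIV (dquot f v t)"
  unfolding dquot_def divide_inverse
  by (intro continuous_intros continuous_on_compose2[OF assms]) auto

lemma AE_lborel_translate_iff:
  fixes a :: "'a::euclidean_space"
  assumes "{x. P x} \<in> sets borel"
  shows "(AE x in lborel. P (a + x)) \<longleftrightarrow> (AE x in lborel. P x)"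
proof -
  have "(AE x in distr lborel borel ((+) a). P x) \<longleftrightarrow> (AE x in lborel. P (a + x))"
    using assms by (intro AE_distr_iff) auto
  then show ?thesis
    unfolding lborel_distr_plus by (rule sym)
qed

text \<open>Holds because Lebesgue measure on the line is nonzero. It discharges the line parameter
  that is left over after Fubini.\<close>

lemma AE_const_lborel: "(AE s in (lborel :: real measure). Q) \<longleftrightarrow> Q"
proof -
  have "ae_filter (lborel :: real measure) \<noteq> bot"
    unfolding trivial_limit_def using AE_E2[where M = "lborel :: real measure" and P = "\<lambda>_. False"] by auto
  then show ?thesis
    by simp
qed

text \<open>No coordinates adapted to \<open>v\<close> are needed: on every line the property holds
  for almost every \<open>s\<close>, Fubini exchanges \<open>x\<close> and \<open>s\<close> in
  \<open>P (x + s *\<^sub>R v)\<close>, and by translation invariance the inner statement about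
  almost every \<open>x\<close> no longer depends on \<open>s\<close>.\<close>

lemma AE_lipschitz_directional:
  fixes f :: "'a::euclidean_space \<Rightarrow> real"
  assumes f: "L-lipschitz_on UNIV f"
  shows "AE x in lborel. \<exists>l. ((\<lambda>t. dquot f v t x) \<longlongrightarrow> l) (at_right 0)"
proof -
  have cont: "continuous_on UNIV f"
    using f by (rule lipschitz_on_continuous_on)
  \<comment> \<open>The union over \<open>s\<close> and \<open>t\<close> is uncountable, but it is
    open, since the inequality is strict and the quotients are continuous in \<open>x\<close>. The
    complement of \<open>U k m\<close> is the non-strict bound in the Cauchy criterion.\<close>
  define U where "U k m = (\<Union>s\<in>{0<..<inverse (real (Suc m))}. \<Union>t\<in>{0<..<inverse (real (Suc m))}.
       {x. inverse (real (Suc k)) < \<bar>dquot f v s x - dquot f v t x\<bar>})" for k m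
  define P where "P x \<longleftrightarrow> (\<exists>l. ((\<lambda>t. dquot f v t x) \<longlongrightarrow> l) (at_right 0))" for x
  have "open (U k m)" for k m
    unfolding U_def
    by (intro open_UN ballI open_Collect_less continuous_intros continuous_on_dquot cont)
  then have [measurable]: "U k m \<in> sets borel" for k m
    by auto
  have P_iff: "P x \<longleftrightarrow> x \<in> (\<Inter>k. \<Union>m. - U k m)" for x
    unfolding P_def ex_tendsto_at_right_iff_Cauchy by (auto simp: U_def not_less simp del: of_nat_Suc)
  have "{x. P x} = (\<Inter>k. \<Union>m. - U k m)"
    using P_iff by blast
  then have P_meas [measurable]: "Measurable.pred borel P"
    by (simp add: pred_def)
  have line: "AE s in lborel. P (x + s *\<^sub>R v)" for x
  proof -
    have "(L * norm v)-lipschitz_on UNIV (\<lambda>s. f (x + s *\<^sub>R v))"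
    proof (rule lipschitz_onI)
      fix s s' :: real
      have "dist (f (x + s *\<^sub>R v)) (f (x + s' *\<^sub>R v)) \<le> L * dist (x + s *\<^sub>R v) (x + s' *\<^sub>R v)"
        by (rule lipschitz_onD[OF f]) auto
      also have "\<dots> = L * norm v * dist s s'"
        by (simp add: dist_norm scaleR_diff_left[symmetric])
      finally show "dist (f (x + s *\<^sub>R v)) (f (x + s' *\<^sub>R v)) \<le> L * norm v * dist s s'" .
    qed (use lipschitz_on_nonneg[OF f] in auto)
    from AE_lipschitz_right_derivative[OF this] show ?thesis
      by (simp add: P_def dquot_def scaleR_add_left add.assoc)
  qed
  have "Measurable.pred (lborel \<Otimes>\<^sub>M lborel) (\<lambda>z. P (fst z + snd z *\<^sub>R v))"
    by measurable
  then have "{z \<in> space (lborel \<Otimes>\<^sub>M lborel). P (fst z + snd z *\<^sub>R v)} \<in> sets (lborel \<Otimes>\<^sub>M (lborel :: real measure))"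
    by (simp add: pred_def)
  from lborel_pair.AE_commute[OF this] line
  have "AE s in (lborel :: real measure). AE x in lborel. P (x + s *\<^sub>R v)"
    by simp
  moreover have "(AE x in lborel. P (x + s *\<^sub>R v)) \<longleftrightarrow> (AE x in lborel. P x)" for s
    using AE_lborel_translate_iff[of P "s *\<^sub>R v"] P_meas by (simp add: pred_def add.commute)
  ultimately have "AE s in (lborel :: real measure). AE x in lborel. P x"
    by simp
  then have "AE x in lborel. P x"
    using AE_const_lborel by blast
  then show ?thesis
    by (simp add: P_def)
qed

text \<open>A one-sided derivative: \<open>dir_deriv f (- v) x = - dir_deriv f v x\<close> is obtained almost everywhere
  from additivity. The limit is taken along a sequence to have measurability for free.\<close>

definition dir_deriv :: "('a::euclidean_space \<Rightarrow> real) \<Rightarrow> 'a \<Rightarrow> 'a \<Rightarrow> real" where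
  "dir_deriv f v x = lim (\<lambda>k. dquot f v (inverse (real (Suc k))) x)"

lemma filterlim_inverse_Suc_at_right: "filterlim (\<lambda>k. inverse (real (Suc k))) (at_right 0) sequentially"
  unfolding filterlim_at using LIMSEQ_inverse_real_of_nat by (simp del: of_nat_Suc)

lemma AE_tendsto_dir_deriv:
  fixes f :: "'a::euclidean_space \<Rightarrow> real"
  assumes f: "L-lipschitz_on UNIV f"
  shows "AE x in lborel. ((\<lambda>t. dquot f v t x) \<longlongrightarrow> dir_deriv f v x) (at_right 0)"
  using AE_lipschitz_directional[OF f, of v]
proof eventually_elim
  case (elim x)
  then obtain l where l: "((\<lambda>t. dquot f v t x) \<longlongrightarrow> l) (at_right 0)" ..
  then have "(\<lambda>k. dquot f v (inverse (real (Suc k))) x) \<longlonglongrightarrow> l"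
    by (rule filterlim_compose[OF _ filterlim_inverse_Suc_at_right])
  then have "dir_deriv f v x = l"
    by (simp add: dir_deriv_def limI)
  with l show ?case by simp
qed

lemma borel_measurable_dquot:
  fixes f :: "'a::euclidean_space \<Rightarrow> real"
  assumes "L-lipschitz_on UNIV f"
  shows "dquot f v t \<in> borel_measurable borel"
  using assms by (intro borel_measurable_continuous_onI continuous_on_dquot lipschitz_on_continuous_on)

lemma borel_measurable_dir_deriv:
  fixes f :: "'a::euclidean_space \<Rightarrow> real"
  assumes "L-lipschitz_on UNIV f"
  shows "dir_deriv f v \<in> borel_measurable borel"
  unfolding dir_deriv_def using borel_measurable_dquot[OF assms] by measurable

section \<open>Linearity of the directional derivative in the direction\<close>

lemma lborel_integral_translate:
  fixes g :: "'a::euclidean_space \<Rightarrow> real"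
  assumes "g \<in> borel_measurable borel"
  shows "(\<integral>x. g (a + x) \<partial>lborel) = (\<integral>x. g x \<partial>lborel)"
proof -
  have "(\<integral>x. g x \<partial>distr lborel borel ((+) a)) = (\<integral>x. g (a + x) \<partial>lborel)"
    using assms by (intro integral_distr) auto
  then show ?thesis
    by (simp add: lborel_distr_plus)
qed

text \<open>The shift \<open>c\<close> of the box prepares for the additivity of \<open>dir_deriv\<close>: the quotient in direction
  \<open>v + w\<close> is the one in direction \<open>v\<close> plus the one in direction \<open>w\<close> at a shifted point, and a
  change of variables moves this shift to the box.\<close>

lemma integrable_indicator_dir_deriv:
  fixes f :: "'a::euclidean_space \<Rightarrow> real"
  assumes f: "L-lipschitz_on UNIV f"
  shows "integrable lborel (\<lambda>x. indicator (cbox a b) x * dir_deriv f w x)" (is ?int)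
    and "(\<lambda>k. \<integral>x. indicator (cbox a b) (x - inverse (real (Suc k)) *\<^sub>R c) *
             dquot f w (inverse (real (Suc k))) x \<partial>lborel)
          \<longlonglongrightarrow> (\<integral>x. indicator (cbox a b) x * dir_deriv f w x \<partial>lborel)" (is ?lim)
proof -
  define \<tau> where "\<tau> k = inverse (real (Suc k))" for k
  have \<tau>: "0 < \<tau> k" "\<tau> k \<le> 1" for k
    by (auto simp: \<tau>_def inverse_le_1_iff)
  have \<tau>_lim: "\<tau> \<longlonglongrightarrow> 0"
    unfolding \<tau>_def by (rule LIMSEQ_inverse_real_of_nat)
  note [measurable] = borel_measurable_dquot[OF f] borel_measurable_dir_deriv[OF f]
  obtain r where r: "\<And>x. x \<in> cbox a b \<Longrightarrow> norm x \<le> r"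
    using bounded_cbox[of a b] by (auto simp: bounded_iff)
  \<comment> \<open>One dominating function serves all \<open>k\<close>: as
    \<open>\<tau> k \<le> 1\<close>, a point that the shift by \<open>\<tau> k *\<^sub>R c\<close>
    brings into the box has norm at most \<open>r + norm c\<close>.\<close>
  define g where "g x = L * norm w * indicator (cball 0 (r + norm c)) x" for x :: 'a
  have "emeasure lborel (cball (0::'a) (r + norm c)) < \<infinity>"
    by (intro emeasure_bounded_finite) auto
  then have g: "integrable lborel g"
    unfolding g_def by (intro integrable_mult_right integrable_real_indicator) auto
  have bound: "norm (indicator (cbox a b) (x - \<tau> k *\<^sub>R c) * dquot f w (\<tau> k) x) \<le> g x" for k x
  proof (cases "x - \<tau> k *\<^sub>R c \<in> cbox a b")
    case True
    have "norm x \<le> norm (x - \<tau> k *\<^sub>R c) + norm (\<tau> k *\<^sub>R c)"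
      by (metis diff_add_cancel norm_triangle_ineq)
    also have "\<dots> \<le> r + norm c"
      using r[OF True] \<tau>[of k] by (auto intro!: add_mono mult_left_le_one_le)
    finally show ?thesis
      using True dquot_bound[OF f \<tau>(1)] by (simp add: g_def)
  qed (use lipschitz_on_nonneg[OF f] in \<open>simp add: g_def\<close>)
  \<comment> \<open>Off the frontier of the box its indicator is locally constant, so a shift that
    tends to 0 eventually has no effect on it.\<close>
  have "negligible (frontier (cbox a b))"
    by (simp add: negligible_convex_frontier)
  then have "AE x in lebesgue. x \<notin> frontier (cbox a b)"
    by (auto simp: eventually_ae_filter_negligible)
  then have fr: "AE x in lborel. x \<notin> frontier (cbox a b)"
    by (simp add: AE_completion_iff)
  have lim: "AE x in lborel. (\<lambda>k. indicator (cbox a b) (x - \<tau> k *\<^sub>R c) * dquot f w (\<tau> k) x)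
      \<longlonglongrightarrow> indicator (cbox a b) x * dir_deriv f w x"
    using fr AE_tendsto_dir_deriv[OF f, of w]
  proof eventually_elim
    case (elim x)
    have "(\<lambda>k. x - \<tau> k *\<^sub>R c) \<longlonglongrightarrow> x - 0 *\<^sub>R c"
      by (intro tendsto_intros \<tau>_lim)
    then have x_lim: "(\<lambda>k. x - \<tau> k *\<^sub>R c) \<longlonglongrightarrow> x"
      by simp
    have "\<forall>\<^sub>F k in sequentially. (indicator (cbox a b) (x - \<tau> k *\<^sub>R c) :: real) = indicator (cbox a b) x"
    proof (cases "x \<in> cbox a b")
      case True
      then have "x \<in> interior (cbox a b)"
        using elim(1) by (simp add: frontier_def)
      then have "\<forall>\<^sub>F k in sequentially. x - \<tau> k *\<^sub>R c \<in> interior (cbox a b)"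
        using topological_tendstoD[OF x_lim open_interior] by blast
      then show ?thesis
        by eventually_elim (use True box_subset_cbox in \<open>auto simp: indicator_def\<close>)
    next
      case False
      then have "\<forall>\<^sub>F k in sequentially. x - \<tau> k *\<^sub>R c \<in> - cbox a b"
        using topological_tendstoD[OF x_lim open_Compl[OF closed_cbox]] by blast
      then show ?thesis
        by eventually_elim (use False in \<open>auto simp: indicator_def\<close>)
    qed
    then have "(\<lambda>k. indicator (cbox a b) (x - \<tau> k *\<^sub>R c) :: real) \<longlonglongrightarrow> indicator (cbox a b) x"
      by (rule tendsto_eventually)
    moreover have "(\<lambda>k. dquot f w (\<tau> k) x) \<longlonglongrightarrow> dir_deriv f w x"
      using elim(2) filterlim_inverse_Suc_at_right unfolding \<tau>_def by (rule filterlim_compose)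
    ultimately show ?case
      by (rule tendsto_mult)
  qed
  show ?int
    by (rule integrable_dominated_convergence[OF _ _ g lim]) (use bound in auto)
  show ?lim
    unfolding \<tau>_def[symmetric]
    by (rule integral_dominated_convergence[OF _ _ g lim]) (use bound in auto)
qed

text \<open>By Lebesgue differentiation \<open>g x\<close> is almost everywhere the limit of
  averages over boxes with corner \<open>x\<close>, and all these averages are 0.\<close>

lemma AE_eq_0_if_integral_cbox_eq_0:
  fixes g :: "'a::euclidean_space \<Rightarrow> real"
  assumes "\<And>a b. (g has_integral 0) (cbox a b)"
  shows "AE x in lborel. g x = 0"
proof -
  have "g integrable_on cbox a b" for a b
    using assms by blast
  then obtain N where N: "negligible N"
    "\<And>x e. \<lbrakk>x \<notin> N; 0 < e\<rbrakk> \<Longrightarrow> \<exists>d>0. \<forall>t. 0 < t \<and> t < d \<longrightarrow>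
       norm (integral (cbox x (x + t *\<^sub>R One)) g /\<^sub>R t ^ DIM('a) - g x) < e"
    by (rule integrable_ccontinuous_explicit) blast
  have "g x = 0" if x: "x \<notin> N" for x
  proof (rule ccontr)
    assume "g x \<noteq> 0"
    then obtain d where "d > 0" "\<And>t. 0 < t \<Longrightarrow> t < d \<Longrightarrow>
       norm (integral (cbox x (x + t *\<^sub>R One)) g /\<^sub>R t ^ DIM('a) - g x) < \<bar>g x\<bar>"
      using N(2)[OF x, of "\<bar>g x\<bar>"] by auto
    from this(2)[of "d / 2"] this(1) show False
      using integral_unique[OF assms] by simp
  qed
  then have "AE x in lebesgue. g x = 0"
    using N(1) unfolding eventually_ae_filter_negligible by blast
  then show ?thesis
    by (simp add: AE_completion_iff)
qed

text \<open>Splitting the quotient evaluates one summand at a moving point, where pointwise limits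
  say nothing. After integration over a box the motion affects only the indicator and disappears in
  the limit; equality of the integrals over all boxes then gives equality almost everywhere.\<close>

lemma AE_dir_deriv_add:
  fixes f :: "'a::euclidean_space \<Rightarrow> real"
  assumes f: "L-lipschitz_on UNIV f"
  shows "AE x in lborel. dir_deriv f (v + w) x = dir_deriv f v x + dir_deriv f w x"
proof -
  define \<tau> where "\<tau> k = inverse (real (Suc k))" for k
  have \<tau>: "0 < \<tau> k" for k
    by (auto simp: \<tau>_def)
  note [measurable] = borel_measurable_dquot[OF f]
  define D where "D x = dir_deriv f (v + w) x - dir_deriv f v x - dir_deriv f w x" for x
  have "(D has_integral 0) (cbox a b)" for a b
  proof -
    let ?I = "\<lambda>x. indicator (cbox a b) x :: real"
    note int = integrable_indicator_dir_deriv(1)[OF f, of a b]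
    note lim = integrable_indicator_dir_deriv(2)[OF f, of a b, folded \<tau>_def]
    have fin: "emeasure lborel (cbox a b) < \<infinity>"
      by (intro emeasure_bounded_finite) auto
    have int_q: "integrable lborel (\<lambda>x. ?I x * dquot f u (\<tau> k) (c + x))" for u k c
    proof (rule Bochner_Integration.integrable_bound)
      show "integrable lborel (\<lambda>x. ?I x * (L * norm u))"
        using fin by (intro integrable_mult_left integrable_real_indicator) auto
      show "AE x in lborel. norm (?I x * dquot f u (\<tau> k) (c + x)) \<le> norm (?I x * (L * norm u))"
        using order_trans[OF dquot_bound[OF f \<tau>] abs_ge_self]
          by (intro AE_I2) (auto simp: indicator_def)
    qed measurable
    have split: "(\<integral>x. ?I x * dquot f (v + w) (\<tau> k) x \<partial>lborel)
        = (\<integral>x. ?I x * dquot f v (\<tau> k) x \<partial>lborel)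
        + (\<integral>x. ?I (x - \<tau> k *\<^sub>R v) * dquot f w (\<tau> k) x \<partial>lborel)" for k
    proof -
      have "dquot f (v + w) (\<tau> k) x = dquot f v (\<tau> k) x + dquot f w (\<tau> k) (\<tau> k *\<^sub>R v + x)" for x
        by (simp add: dquot_def algebra_simps diff_divide_distrib add_divide_distrib)
      then have "(\<integral>x. ?I x * dquot f (v + w) (\<tau> k) x \<partial>lborel)
        = (\<integral>x. ?I x * dquot f v (\<tau> k) x + ?I x * dquot f w (\<tau> k) (\<tau> k *\<^sub>R v + x) \<partial>lborel)"
        by (simp add: distrib_left)
      also have "\<dots> = (\<integral>x. ?I x * dquot f v (\<tau> k) x \<partial>lborel)
          + (\<integral>x. ?I x * dquot f w (\<tau> k) (\<tau> k *\<^sub>R v + x) \<partial>lborel)"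
        using int_q[of v k 0] int_q by (intro Bochner_Integration.integral_add) auto
      also have "(\<integral>x. ?I x * dquot f w (\<tau> k) (\<tau> k *\<^sub>R v + x) \<partial>lborel)
          = (\<integral>x. ?I (x - \<tau> k *\<^sub>R v) * dquot f w (\<tau> k) x \<partial>lborel)"
        using lborel_integral_translate[of "\<lambda>x. ?I (x - \<tau> k *\<^sub>R v) * dquot f w (\<tau> k) x" "\<tau> k *\<^sub>R v"]
        by simp
      finally show ?thesis .
    qed
    \<comment> \<open>The limit lemma is used with shift 0 for direction \<open>v\<close> and with
      shift \<open>v\<close> for direction \<open>w\<close>.\<close>
    have "(\<lambda>k. \<integral>x. ?I x * dquot f (v + w) (\<tau> k) x \<partial>lborel)
       \<longlonglongrightarrow> (\<integral>x. ?I x * dir_deriv f v x \<partial>lborel) + (\<integral>x. ?I x * dir_deriv f w x \<partial>lborel)"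
      unfolding split using lim[of 0 v] lim[of v w] by (intro tendsto_add) auto
    moreover have "(\<lambda>k. \<integral>x. ?I x * dquot f (v + w) (\<tau> k) x \<partial>lborel)
       \<longlonglongrightarrow> (\<integral>x. ?I x * dir_deriv f (v + w) x \<partial>lborel)"
      using lim[of 0 "v + w"] by simp
    ultimately have eq: "(\<integral>x. ?I x * dir_deriv f (v + w) x \<partial>lborel)
      = (\<integral>x. ?I x * dir_deriv f v x \<partial>lborel) + (\<integral>x. ?I x * dir_deriv f w x \<partial>lborel)"
      using LIMSEQ_unique by blast
    have D: "?I x * D x = ?I x * dir_deriv f (v + w) x - ?I x * dir_deriv f v x - ?I x * dir_deriv f w x" for x
      by (simp add: D_def algebra_simps)
    have "integrable lborel (\<lambda>x. ?I x * D x)"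
      unfolding D using int by auto
    then have "set_integrable lborel (cbox a b) D"
      by (simp add: set_integrable_def)
    moreover have "(LINT x:cbox a b|lborel. D x) = 0"
      using int eq by (simp add: set_lebesgue_integral_def D)
    ultimately show ?thesis
      using set_borel_integral_eq_integral by (metis has_integral_integral)
  qed
  then have "AE x in lborel. D x = 0"
    by (rule AE_eq_0_if_integral_cbox_eq_0)
  then show ?thesis
    by eventually_elim (simp add: D_def)
qed

text \<open>Substituting \<open>c * t\<close> for \<open>t\<close> respects the one-sided limit at 0
  because \<open>c\<close> is positive. Negative factors are reached through additivity.\<close>

lemma AE_dir_deriv_scaleR_pos:
  fixes f :: "'a::euclidean_space \<Rightarrow> real"
  assumes f: "L-lipschitz_on UNIV f" and c: "c > 0"
  shows "AE x in lborel. dir_deriv f (c *\<^sub>R v) x = c * dir_deriv f v x"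
  using AE_tendsto_dir_deriv[OF f, of v] AE_tendsto_dir_deriv[OF f, of "c *\<^sub>R v"]
proof eventually_elim
  case (elim x)
  have "filterlim (\<lambda>t. c * t) (at_right 0) (at_right 0)"
    unfolding filterlim_at
  proof
    show "\<forall>\<^sub>F t in at_right 0. c * t \<in> {0<..} \<and> c * t \<noteq> 0"
      using eventually_at_right_less[of 0] by eventually_elim (use c in auto)
  qed (auto intro!: tendsto_eq_intros)
  then have "((\<lambda>t. c * dquot f v (c * t) x) \<longlongrightarrow> c * dir_deriv f v x) (at_right 0)"
    by (intro tendsto_mult_left filterlim_compose[OF elim(1)])
  moreover have "c * dquot f v (c * t) x = dquot f (c *\<^sub>R v) t x" for t
    using c by (simp add: dquot_def mult.commute)
  ultimately have "((\<lambda>t. dquot f (c *\<^sub>R v) t x) \<longlongrightarrow> c * dir_deriv f v x) (at_right 0)"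
    by simp
  with elim(2) show ?case
    by (rule tendsto_unique[OF trivial_limit_at_right_real])
qed

lemma dir_deriv_0: "dir_deriv f 0 x = 0"
  by (simp add: dir_deriv_def dquot_def)

lemma AE_dir_deriv_scaleR:
  fixes f :: "'a::euclidean_space \<Rightarrow> real"
  assumes f: "L-lipschitz_on UNIV f"
  shows "AE x in lborel. dir_deriv f (c *\<^sub>R v) x = c * dir_deriv f v x"
proof -
  consider "c > 0" | "c = 0" | "- c > 0"
    by linarith
  then show ?thesis
  proof cases
    \<comment> \<open>Additivity for the opposite vectors \<open>c *\<^sub>R v\<close> and
      \<open>(- c) *\<^sub>R v\<close>, whose sum has derivative 0, reduces this to the positive
      factor \<open>- c\<close>.\<close>
    case 3
    from AE_dir_deriv_scaleR_pos[OF f this, of v] AE_dir_deriv_add[OF f, of "c *\<^sub>R v" "(- c) *\<^sub>R v"]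
    show ?thesis
      by eventually_elim (simp add: dir_deriv_0)
  qed (simp_all add: AE_dir_deriv_scaleR_pos[OF f] dir_deriv_0)
qed

lemma AE_dir_deriv_sum:
  fixes f :: "'a::euclidean_space \<Rightarrow> real"
  assumes f: "L-lipschitz_on UNIV f" and "finite A"
  shows "AE x in lborel. dir_deriv f (\<Sum>i\<in>A. c i *\<^sub>R i) x = (\<Sum>i\<in>A. c i * dir_deriv f i x)"
  using \<open>finite A\<close>
proof (induction A)
  case empty
  then show ?case
    by (simp add: dir_deriv_0)
next
  case (insert i A)
  from insert.IH AE_dir_deriv_add[OF f, of "c i *\<^sub>R i" "\<Sum>i\<in>A. c i *\<^sub>R i"] AE_dir_deriv_scaleR[OF f, of "c i" i]
  show ?case
    by eventually_elim (use insert.hyps in simp)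
qed

lemma AE_dir_deriv_eq_inner:
  fixes f :: "'a::euclidean_space \<Rightarrow> real"
  assumes f: "L-lipschitz_on UNIV f"
  shows "AE x in lborel. dir_deriv f v x = v \<bullet> (\<Sum>i\<in>Basis. dir_deriv f i x *\<^sub>R i)"
  using AE_dir_deriv_sum[OF f finite_Basis, of "\<lambda>i. v \<bullet> i"]
  by eventually_elim (simp add: euclidean_representation inner_sum_right mult.commute)

section \<open>From a dense set of directions to differentiability\<close>

text \<open>By compactness of the unit sphere, finitely many directions of \<open>D\<close>
  approximate all unit directions. Finitely many quotients converge uniformly, and the Lipschitz
  bound transfers the estimate to every nearby direction.\<close>

lemma GDERIV_if_dense_directions:
  fixes f :: "'a::euclidean_space \<Rightarrow> real"
  assumes f: "L-lipschitz_on UNIV f"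
    and dense: "\<And>S. open S \<Longrightarrow> S \<noteq> {} \<Longrightarrow> \<exists>v\<in>D. v \<in> S"
    and D: "\<And>v. v \<in> D \<Longrightarrow> ((\<lambda>t. dquot f v t x) \<longlongrightarrow> v \<bullet> G) (at_right 0)"
  shows "GDERIV f x :> G"
  unfolding gderiv_def has_derivative_at_alt
proof (intro conjI allI impI)
  show "bounded_linear (\<lambda>h. h \<bullet> G)"
    by (rule bounded_linear_inner_left)
  fix e :: real assume "e > 0"
  have "L \<ge> 0" using f by (rule lipschitz_on_nonneg)
  \<comment> \<open>The three summands pay for three errors, each relative to
    \<open>t * \<eta>\<close>: replacing \<open>w\<close> by \<open>v\<close> in the argument of
    \<open>f\<close> costs \<open>L\<close>, the quotient in direction \<open>v\<close> costs 1, and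
    replacing \<open>v\<close> by \<open>w\<close> in the inner product costs
    \<open>norm G\<close>.\<close>
  define K where "K = L + 1 + norm G"
  define \<eta> where "\<eta> = e / K"
  have "K > 0" using \<open>L \<ge> 0\<close> norm_ge_zero[of G] unfolding K_def by linarith
  then have "\<eta> > 0" "K * \<eta> = e" using \<open>e > 0\<close> by (auto simp: \<eta>_def)
  have cover: "sphere 0 1 \<subseteq> (\<Union>v\<in>D. ball v \<eta>)"
  proof
    fix w :: 'a
    obtain v where "v \<in> D" "v \<in> ball w \<eta>"
      using dense[of "ball w \<eta>"] \<open>\<eta> > 0\<close> by auto
    then show "w \<in> (\<Union>v\<in>D. ball v \<eta>)"
      by (auto simp: dist_commute)
  qed
  obtain D' where D': "D' \<subseteq> D" "finite D'" "sphere 0 1 \<subseteq> (\<Union>v\<in>D'. ball v \<eta>)"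
    by (rule compactE_image[OF compact_sphere _ cover]) auto
  have "\<forall>\<^sub>F t in at_right 0. \<forall>v\<in>D'. dist (dquot f v t x) (v \<bullet> G) < \<eta>"
    using D'(1) by (intro eventually_ball_finite[OF D'(2)] ballI tendstoD[OF D \<open>\<eta> > 0\<close>]) auto
  then obtain d where "d > 0" and d: "\<And>t v. 0 < t \<Longrightarrow> t < d \<Longrightarrow> v \<in> D' \<Longrightarrow> dist (dquot f v t x) (v \<bullet> G) < \<eta>"
    by (auto simp: eventually_at_right_field)
  have "norm (f y - f x - (y - x) \<bullet> G) \<le> e * norm (y - x)" if y: "norm (y - x) < d" for y
  proof (cases "y = x")
    case False
    define t where "t = norm (y - x)"
    define w where "w = (y - x) /\<^sub>R t"
    have "t > 0" using False by (simp add: t_def)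
    have yx: "y - x = t *\<^sub>R w" and y_eq: "y = x + t *\<^sub>R w"
      using \<open>t > 0\<close> by (auto simp: w_def)
    have "norm w = 1"
      using \<open>t > 0\<close> by (simp add: w_def t_def[symmetric])
    then obtain v where v: "v \<in> D'" "norm (v - w) < \<eta>"
      using D'(3) by (force simp: dist_norm)
    have 1: "\<bar>f y - f (x + t *\<^sub>R v)\<bar> \<le> t * (L * \<eta>)"
    proof -
      have "\<bar>f y - f (x + t *\<^sub>R v)\<bar> \<le> L * norm (t *\<^sub>R (v - w))"
        using lipschitz_onD[OF f, of "x + t *\<^sub>R v" y] by (simp add: y_eq dist_norm algebra_simps abs_minus_commute)
      also have "\<dots> \<le> L * (t * \<eta>)"
        using \<open>L \<ge> 0\<close> \<open>t > 0\<close> v(2) by (intro mult_left_mono) auto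
      finally show ?thesis by (simp add: algebra_simps)
    qed
    have 2: "\<bar>f (x + t *\<^sub>R v) - f x - t * (v \<bullet> G)\<bar> \<le> t * \<eta>"
    proof -
      have "f (x + t *\<^sub>R v) - f x - t * (v \<bullet> G) = t * (dquot f v t x - v \<bullet> G)"
        using \<open>t > 0\<close> by (simp add: dquot_def field_simps)
      moreover have "\<bar>dquot f v t x - v \<bullet> G\<bar> < \<eta>"
        using d[OF \<open>t > 0\<close> _ v(1)] y by (simp add: t_def dist_real_def)
      ultimately show ?thesis
        using \<open>t > 0\<close> by (simp add: abs_mult)
    qed
    have 3: "\<bar>t * ((v - w) \<bullet> G)\<bar> \<le> t * (norm G * \<eta>)"
    proof -
      have "\<bar>(v - w) \<bullet> G\<bar> \<le> norm (v - w) * norm G"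
        by (rule Cauchy_Schwarz_ineq2)
      also have "\<dots> \<le> \<eta> * norm G"
        using v(2) by (intro mult_right_mono) auto
      finally show ?thesis
        using \<open>t > 0\<close> by (simp add: abs_mult mult.commute)
    qed
    have "f y - f x - (y - x) \<bullet> G
      = (f y - f (x + t *\<^sub>R v)) + (f (x + t *\<^sub>R v) - f x - t * (v \<bullet> G)) + t * ((v - w) \<bullet> G)"
      by (simp add: yx inner_diff_left algebra_simps)
    then have "\<bar>f y - f x - (y - x) \<bullet> G\<bar> \<le> t * (L * \<eta>) + t * \<eta> + t * (norm G * \<eta>)"
      using 1 2 3 by linarith
    also have "\<dots> = t * (K * \<eta>)"
      by (simp add: K_def algebra_simps)
    finally show ?thesis
      using \<open>K * \<eta> = e\<close> by (simp add: t_def mult.commute)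
  qed simp
  then show "\<exists>d>0. \<forall>y. norm (y - x) < d \<longrightarrow> norm (f y - f x - (y - x) \<bullet> G) \<le> e * norm (y - x)"
    using \<open>d > 0\<close> by blast
qed

theorem rademacher:
  fixes f :: "'a::euclidean_space \<Rightarrow> real"
  assumes f: "L-lipschitz_on UNIV f"
  shows "AE x in lborel. \<exists>G. GDERIV f x :> G"
proof -
  obtain D :: "'a set" where D: "countable D" "\<And>S. open S \<Longrightarrow> S \<noteq> {} \<Longrightarrow> \<exists>v\<in>D. v \<in> S"
    using countable_dense_setE by blast
  \<comment> \<open>The exceptional null set depends on \<open>v\<close>; countability of
    \<open>D\<close> gives one null set for all its directions.\<close>
  have "AE x in lborel. \<forall>v\<in>D. dir_deriv f v x = v \<bullet> (\<Sum>i\<in>Basis. dir_deriv f i x *\<^sub>R i)"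
    using D(1) AE_dir_deriv_eq_inner[OF f] by (intro AE_ball_countable') auto
  moreover have "AE x in lborel. \<forall>v\<in>D. ((\<lambda>t. dquot f v t x) \<longlongrightarrow> dir_deriv f v x) (at_right 0)"
    using D(1) AE_tendsto_dir_deriv[OF f] by (intro AE_ball_countable') auto
  ultimately show ?thesis
  proof eventually_elim
    case (elim x)
    show ?case
      by (rule exI, rule GDERIV_if_dense_directions[OF f D(2)]) (use elim in auto)
  qed
qed

section \<open>Goldstein subdifferentials\<close>

lemma GDERIV_tendsto_dquot:
  fixes f :: "'a::euclidean_space \<Rightarrow> real"
  assumes "GDERIV f x :> G"
  shows "((\<lambda>t. dquot f v t x) \<longlongrightarrow> v \<bullet> G) (at_right 0)"
proof -
  have "((\<lambda>t. f (x + t *\<^sub>R v)) has_derivative (\<lambda>t. (t *\<^sub>R v) \<bullet> G)) (at 0)"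
  proof (rule has_derivative_compose[where f = "\<lambda>t. x + t *\<^sub>R v" and f' = "\<lambda>t. t *\<^sub>R v"])
    show "((\<lambda>t. x + t *\<^sub>R v) has_derivative (\<lambda>t. t *\<^sub>R v)) (at 0)"
      by (auto intro!: derivative_eq_intros)
    show "(f has_derivative (\<lambda>h. h \<bullet> G)) (at (x + 0 *\<^sub>R v))"
      using assms by (simp add: gderiv_def)
  qed
  then have "((\<lambda>t. f (x + t *\<^sub>R v)) has_field_derivative (v \<bullet> G)) (at 0)"
    by (rule has_derivative_imp_has_field_derivative) simp
  then have "((\<lambda>t. dquot f v t x) \<longlongrightarrow> v \<bullet> G) (at 0)"
    by (simp add: DERIV_def dquot_def)
  then show ?thesis
    by (rule tendsto_within_subset) auto
qed

text \<open>Testing the derivative in the direction of the gradient itself gives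
  \<open>G \<bullet> G \<le> L * norm G\<close>.\<close>

lemma GDERIV_norm_le:
  fixes f :: "'a::euclidean_space \<Rightarrow> real"
  assumes f: "L-lipschitz_on UNIV f" and G: "GDERIV f x :> G"
  shows "norm G \<le> L"
proof -
  have "\<forall>\<^sub>F t in at_right 0. dquot f G t x \<le> L * norm G"
    using eventually_at_right_less[of 0]
    by eventually_elim (use abs_le_D1[OF dquot_bound[OF f]] in blast)
  then have "G \<bullet> G \<le> L * norm G"
    by (intro tendsto_upperbound[OF GDERIV_tendsto_dquot[OF G, of G]]) auto
  then have "norm G * norm G \<le> L * norm G"
    by (simp add: dot_square_norm power2_eq_square)
  then show ?thesis
    using lipschitz_on_nonneg[OF f] by (cases "norm G = 0") auto
qed

section \<open>Subdifferentials through the closure of the gradient graph\<close>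

definition gradient_graph :: "('a::euclidean_space \<Rightarrow> real) \<Rightarrow> ('a \<times> 'a) set" where
  "gradient_graph f = {(y, g). GDERIV f y :> g}"

text \<open>Points and gradients converge jointly exactly when the pairs converge in the product
  space. Limits of gradients thus become sections of a single closed set.\<close>

lemma clarke_subdifferential_eq:
  "clarke_subdifferential f x = convex hull {g. (x, g) \<in> closure (gradient_graph f)}"
proof -
  have "(\<exists>X G. (\<forall>n::nat. GDERIV f (X n) :> G n) \<and> X \<longlonglongrightarrow> x \<and> G \<longlonglongrightarrow> g) \<longleftrightarrow>
      (x, g) \<in> closure (gradient_graph f)" for g
  proof
    assume "\<exists>X G. (\<forall>n::nat. GDERIV f (X n) :> G n) \<and> X \<longlonglongrightarrow> x \<and> G \<longlonglongrightarrow> g"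
    then obtain X G where XG: "\<And>n. GDERIV f (X n) :> G n" "X \<longlonglongrightarrow> x" "G \<longlonglongrightarrow> g"
      by blast
    have "(\<lambda>n. (X n, G n)) \<longlonglongrightarrow> (x, g)"
      by (intro tendsto_Pair XG)
    then show "(x, g) \<in> closure (gradient_graph f)"
      unfolding closure_sequential using XG(1)
      by (intro exI[of _ "\<lambda>n. (X n, G n)"]) (simp add: gradient_graph_def)
  next
    assume "(x, g) \<in> closure (gradient_graph f)"
    then obtain Z where "\<And>n. Z n \<in> gradient_graph f" "Z \<longlonglongrightarrow> (x, g)"
      unfolding closure_sequential by blast
    then show "\<exists>X G. (\<forall>n::nat. GDERIV f (X n) :> G n) \<and> X \<longlonglongrightarrow> x \<and> G \<longlonglongrightarrow> g"
      using tendsto_fst[of Z "(x, g)"] tendsto_snd[of Z "(x, g)"]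
      by (intro exI[of _ "\<lambda>n. fst (Z n)"] exI[of _ "\<lambda>n. snd (Z n)"])
        (auto simp: gradient_graph_def case_prod_beta)
  qed
  then show ?thesis
    by (simp add: clarke_subdifferential_def)
qed

text \<open>These are the limits of gradients over the whole ball before any convex hull. The form
  as a projection of part of one closed set makes compactness accessible although the union over the
  ball is uncountable.\<close>

definition limiting_gradients :: "real \<Rightarrow> ('a::euclidean_space \<Rightarrow> real) \<Rightarrow> 'a \<Rightarrow> 'a set" where
  "limiting_gradients \<delta> f x = snd ` (closure (gradient_graph f) \<inter> cball x \<delta> \<times> UNIV)"

text \<open>The inner convex hulls, one per point of the ball, are absorbed by the outer
  one.\<close>

lemma goldstein_subdifferential_eq:
  "goldstein_subdifferential \<delta> f x = convex hull (limiting_gradients \<delta> f x)"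
proof -
  let ?C = "\<lambda>y. {g. (y, g) \<in> closure (gradient_graph f)}"
  have U: "limiting_gradients \<delta> f x = (\<Union>y\<in>cball x \<delta>. ?C y)"
    by (force simp: limiting_gradients_def)
  have "convex hull (\<Union>y\<in>cball x \<delta>. convex hull ?C y) = convex hull (\<Union>y\<in>cball x \<delta>. ?C y)"
  proof (rule antisym)
    have "convex hull ?C y \<subseteq> convex hull (\<Union>y\<in>cball x \<delta>. ?C y)" if "y \<in> cball x \<delta>" for y
      using that by (intro hull_mono UN_upper)
    then have "(\<Union>y\<in>cball x \<delta>. convex hull ?C y) \<subseteq> convex hull (\<Union>y\<in>cball x \<delta>. ?C y)"
      by (rule UN_least)
    then show "convex hull (\<Union>y\<in>cball x \<delta>. convex hull ?C y) \<subseteq> convex hull (\<Union>y\<in>cball x \<delta>. ?C y)"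
      by (rule hull_minimal) (rule convex_convex_hull)
    show "convex hull (\<Union>y\<in>cball x \<delta>. ?C y) \<subseteq> convex hull (\<Union>y\<in>cball x \<delta>. convex hull ?C y)"
      by (intro hull_mono UN_mono hull_subset subset_refl)
  qed
  then show ?thesis
    by (simp add: goldstein_subdifferential_def clarke_subdifferential_eq U)
qed

lemma closure_gradient_graph_subset:
  fixes f :: "'a::euclidean_space \<Rightarrow> real"
  assumes f: "L-lipschitz_on UNIV f"
  shows "closure (gradient_graph f) \<subseteq> UNIV \<times> cball 0 L"
  by (rule closure_minimal)
    (use GDERIV_norm_le[OF f] in \<open>auto simp: gradient_graph_def intro: closed_Times\<close>)

lemma compact_limiting_gradients:
  fixes f :: "'a::euclidean_space \<Rightarrow> real"
  assumes f: "L-lipschitz_on UNIV f"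
  shows "compact (limiting_gradients \<delta> f x)"
proof -
  have "closure (gradient_graph f) \<inter> cball x \<delta> \<times> UNIV = closure (gradient_graph f) \<inter> cball x \<delta> \<times> cball 0 L"
    using closure_gradient_graph_subset[OF f] by auto
  moreover have "compact (closure (gradient_graph f) \<inter> cball x \<delta> \<times> cball 0 L)"
    by (intro closed_Int_compact compact_Times) auto
  ultimately show ?thesis
    unfolding limiting_gradients_def by (auto intro!: compact_continuous_image continuous_intros)
qed

lemma compact_goldstein_subdifferential:
  fixes f :: "'a::euclidean_space \<Rightarrow> real"
  assumes "L-lipschitz_on UNIV f"
  shows "compact (goldstein_subdifferential \<delta> f x)"
  unfolding goldstein_subdifferential_eq
  by (intro compact_convex_hull compact_limiting_gradients[OF assms])

text \<open>By Rademacher's theorem the points of differentiability are dense: the complement of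
  their closure is open and null, hence empty. Gradients along a sequence tending to
  \<open>x\<close> are bounded by \<open>L\<close>, so a subsequence converges.\<close>

lemma goldstein_subdifferential_nonempty:
  fixes f :: "'a::euclidean_space \<Rightarrow> real"
  assumes f: "L-lipschitz_on UNIV f" and "\<delta> \<ge> 0"
  shows "goldstein_subdifferential \<delta> f x \<noteq> {}"
proof -
  define S where "S = {y. \<exists>G. GDERIV f y :> G}"
  have "x \<in> closure S"
  proof (rule ccontr)
    assume x: "x \<notin> closure S"
    have "AE y in lebesgue. y \<in> S"
      using AE_completion[OF rademacher[OF f]] by (simp add: S_def)
    then obtain N where N: "negligible N" "{y. y \<notin> S} \<subseteq> N"
      unfolding eventually_ae_filter_negligible by blast
    have "- closure S \<subseteq> N"
      using N(2) closure_subset[of S] by blast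
    with N(1) have "negligible (- closure S)"
      by (rule negligible_subset)
    then show False
      using open_not_negligible[of "- closure S"] x by auto
  qed
  then obtain X where X: "\<And>n::nat. \<exists>G. GDERIV f (X n) :> G" "X \<longlonglongrightarrow> x"
    unfolding closure_sequential S_def by blast
  then obtain G where G: "\<And>n. GDERIV f (X n) :> G n"
    by metis
  have "G n \<in> cball 0 L" for n
    using GDERIV_norm_le[OF f G] by simp
  then obtain g r where gr: "strict_mono r" "(G \<circ> r) \<longlonglongrightarrow> g"
    using compact_cball[of 0 L, unfolded compact_def] by meson
  have "g \<in> clarke_subdifferential f x"
    unfolding clarke_subdifferential_def
  proof (rule hull_inc, intro CollectI exI conjI allI)
    show "GDERIV f ((X \<circ> r) n) :> (G \<circ> r) n" for n
      using G by simp
    show "(X \<circ> r) \<longlonglongrightarrow> x"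
      using X(2) gr(1) by (rule LIMSEQ_subseq_LIMSEQ)
    show "(G \<circ> r) \<longlonglongrightarrow> g"
      by (rule gr(2))
  qed
  then have "g \<in> goldstein_subdifferential \<delta> f x"
    unfolding goldstein_subdifferential_def using \<open>\<delta> \<ge> 0\<close>
    by (intro hull_inc UN_I[of x]) auto
  then show ?thesis by blast
qed

lemma goldstein_subdifferential_mono:
  "\<delta> \<le> \<delta>' \<Longrightarrow> goldstein_subdifferential \<delta> f x \<subseteq> goldstein_subdifferential \<delta>' f x"
  unfolding goldstein_subdifferential_def by (intro hull_mono UN_mono) auto

text \<open>A hyperplane strictly separates \<open>g\<close> from the compact convex set. Pairs of a
  point and a limiting gradient on the wrong side form a compact set whose points all lie farther
  than \<open>\<delta>\<close> from \<open>x\<close>, hence at a distance bounded away from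
  \<open>\<delta>\<close>; this gap yields \<open>\<eta>\<close>.\<close>

lemma goldstein_subdifferential_separation:
  fixes f :: "'a::euclidean_space \<Rightarrow> real"
  assumes f: "L-lipschitz_on UNIV f" and g: "g \<notin> goldstein_subdifferential \<delta> f x"
  obtains u b \<eta> where "u \<bullet> g < b" "\<eta> > 0"
    "\<And>w s. w \<in> cball x (\<delta> + \<eta>) \<Longrightarrow> GDERIV f w :> s \<Longrightarrow> b \<le> u \<bullet> s"
proof -
  obtain u b where ub: "u \<bullet> g < b" "\<And>s. s \<in> goldstein_subdifferential \<delta> f x \<Longrightarrow> b < u \<bullet> s"
    using separating_hyperplane_closed_point[OF _ compact_imp_closed[OF compact_goldstein_subdifferential[OF f]] g]
    unfolding goldstein_subdifferential_def by (metis convex_convex_hull)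
  \<comment> \<open>The radius \<open>\<delta> + 1\<close> only serves to make \<open>K\<close>
    bounded. The wrong side includes \<open>u \<bullet> snd z = b\<close>, which keeps
    \<open>K\<close> closed.\<close>
  define K where "K = closure (gradient_graph f) \<inter> (cball x (\<delta> + 1) \<times> cball 0 L) \<inter> {z. u \<bullet> snd z \<le> b}"
  have "compact K"
    unfolding K_def
    by (intro compact_Int_closed closed_Int_compact compact_Times closed_Collect_le continuous_intros) auto
  have far: "dist x (fst z) > \<delta>" if "z \<in> K" for z
  proof (rule ccontr)
    assume "\<not> ?thesis"
    then have "snd z \<in> limiting_gradients \<delta> f x"
      using that by (force simp: K_def limiting_gradients_def)
    then have "snd z \<in> goldstein_subdifferential \<delta> f x"
      unfolding goldstein_subdifferential_eq by (rule hull_inc)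
    from ub(2)[OF this] show False
      using that by (simp add: K_def)
  qed
  obtain m where m: "m > \<delta>" "\<And>z. z \<in> K \<Longrightarrow> m \<le> dist x (fst z)"
  proof (cases "K = {}")
    case True
    then show ?thesis
      using that[of "\<delta> + 1"] by simp
  next
    case False
    have "continuous_on K (\<lambda>z. dist x (fst z))"
      by (intro continuous_intros)
    from continuous_attains_inf[OF \<open>compact K\<close> False this]
    obtain z where "z \<in> K" "\<And>y. y \<in> K \<Longrightarrow> dist x (fst z) \<le> dist x (fst y)"
      by blast
    with far that show ?thesis
      by blast
  qed
  \<comment> \<open>The bound 1 keeps the enlarged ball inside the one used for \<open>K\<close>,
    and half of the gap gives \<open>\<delta> + \<eta> < m\<close>.\<close>
  define \<eta> where "\<eta> = min 1 ((m - \<delta>) / 2)"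
  show thesis
  proof (rule that[OF ub(1)])
    show "\<eta> > 0"
      using m(1) by (simp add: \<eta>_def)
    show "b \<le> u \<bullet> s" if w: "w \<in> cball x (\<delta> + \<eta>)" and s: "GDERIV f w :> s" for w s
    proof (rule ccontr)
      assume "\<not> b \<le> u \<bullet> s"
      moreover have "(w, s) \<in> closure (gradient_graph f)"
        using s closure_subset by (fastforce simp: gradient_graph_def)
      moreover have "\<delta> + \<eta> \<le> \<delta> + 1" "\<delta> + \<eta> < m"
        using m(1) by (auto simp: \<eta>_def min_def field_simps)
      ultimately have "(w, s) \<in> K"
        using w GDERIV_norm_le[OF f s] by (auto simp: K_def)
      from m(2)[OF this] w \<open>\<delta> + \<eta> < m\<close> show False
        by simp
    qed
  qed
qed

section \<open>Uniform smoothing\<close>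

lemma emeasure_lborel_unit_cball:
  "emeasure lborel (cball (0::'a::euclidean_space) 1) \<noteq> 0"
  "emeasure lborel (cball (0::'a) 1) < \<infinity>"
proof -
  show "emeasure lborel (cball (0::'a) 1) < \<infinity>"
    by (intro emeasure_bounded_finite) auto
  have "\<not> negligible (cball (0::'a) 1)"
    using open_not_negligible[of "ball (0::'a) 1"] negligible_subset[OF _ ball_subset_cball] by auto
  then show "emeasure lborel (cball (0::'a) 1) \<noteq> 0"
    by (simp add: negligible_iff_emeasure0)
qed

abbreviation unif :: "'a::euclidean_space measure" where
  "unif \<equiv> uniform_measure lborel (cball 0 1)"

lemma prob_space_unif: "prob_space (unif :: 'a::euclidean_space measure)"
  using emeasure_lborel_unit_cball by (intro prob_space_uniform_measure) (simp_all add: less_top)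

lemma AE_unif_iff: "(AE z in unif. P z) \<longleftrightarrow> (AE z in lborel. z \<in> cball 0 1 \<longrightarrow> P z)"
  using emeasure_lborel_unit_cball by (intro AE_uniform_measure)

text \<open>Up to a constant factor, Lebesgue measure is its own image under the affine map. As
  \<open>P\<close> may fail to be measurable, the transfer is made for a measurable null set
  \<open>N\<close> outside which \<open>P\<close> holds.\<close>

lemma AE_lborel_affine:
  fixes y :: "'a::euclidean_space"
  assumes "AE x in lborel. P x" "c \<noteq> 0"
  shows "AE z in lborel. P (y + c *\<^sub>R z)"
proof -
  obtain N where N: "\<And>x. x \<notin> N \<Longrightarrow> P x" "N \<in> null_sets lborel"
    using assms(1) by (rule AE_E3) auto
  have "AE x in lborel. x \<notin> N"
    using N(2) by (rule AE_not_in)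
  then have "AE x in density (distr lborel borel (\<lambda>z. y + c *\<^sub>R z)) (\<lambda>_. ennreal (\<bar>c\<bar> ^ DIM('a))). x \<notin> N"
    by (subst (asm) lborel_affine[OF assms(2), of y])
  then have "AE x in distr lborel borel (\<lambda>z. y + c *\<^sub>R z). x \<notin> N"
    using assms(2) by (simp add: AE_density)
  then have "AE z in lborel. y + c *\<^sub>R z \<notin> N"
    using N(2) by (subst (asm) AE_distr_iff) auto
  then show ?thesis
    by eventually_elim (rule N(1))
qed

lemma integrable_smoothing:
  fixes f :: "'a::euclidean_space \<Rightarrow> real"
  assumes f: "L-lipschitz_on UNIV f" and "\<rho> \<ge> 0"
  shows "integrable unif (\<lambda>z. f (y + \<rho> *\<^sub>R z))"
proof -
  interpret prob_space "unif :: 'a measure" by (rule prob_space_unif)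
  have cont: "continuous_on UNIV f"
    using f by (rule lipschitz_on_continuous_on)
  show ?thesis
  proof (rule integrable_const_bound)
    have "norm (f (y + \<rho> *\<^sub>R z)) \<le> \<bar>f y\<bar> + L * \<rho>" if "norm z \<le> 1" for z
    proof -
      have "\<bar>f (y + \<rho> *\<^sub>R z) - f y\<bar> \<le> L * norm (\<rho> *\<^sub>R z)"
        using lipschitz_onD[OF f, of "y + \<rho> *\<^sub>R z" y] by (simp add: dist_norm)
      also have "\<dots> \<le> L * \<rho>"
        using that assms(2) lipschitz_on_nonneg[OF f] by (intro mult_left_mono) (auto intro: mult_left_le)
      finally show ?thesis by simp
    qed
    then show "AE z in unif. norm (f (y + \<rho> *\<^sub>R z)) \<le> \<bar>f y\<bar> + L * \<rho>"
      unfolding AE_unif_iff by simp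
    have "continuous_on UNIV (\<lambda>z. f (y + \<rho> *\<^sub>R z))"
      by (intro continuous_on_compose2[OF cont] continuous_intros) auto
    then have "(\<lambda>z. f (y + \<rho> *\<^sub>R z)) \<in> borel_measurable borel"
      by (rule borel_measurable_continuous_onI)
    then show "(\<lambda>z. f (y + \<rho> *\<^sub>R z)) \<in> borel_measurable unif"
      by (simp cong: measurable_cong_sets)
  qed
qed

lemma uniform_smoothing_0: "uniform_smoothing f 0 = f"
proof -
  interpret prob_space "unif :: 'a measure" by (rule prob_space_unif)
  show ?thesis
    using prob_space by (auto simp: uniform_smoothing_def)
qed

lemma lipschitz_on_uniform_smoothing:
  fixes f :: "'a::euclidean_space \<Rightarrow> real"
  assumes f: "L-lipschitz_on UNIV f" and "\<rho> \<ge> 0"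
  shows "L-lipschitz_on UNIV (uniform_smoothing f \<rho>)"
proof (rule lipschitz_onI)
  interpret prob_space "unif :: 'a measure" by (rule prob_space_unif)
  have le: "uniform_smoothing f \<rho> x - uniform_smoothing f \<rho> y \<le> L * dist x y" for x y
  proof -
    have "uniform_smoothing f \<rho> x - uniform_smoothing f \<rho> y
        = (\<integral>z. f (x + \<rho> *\<^sub>R z) - f (y + \<rho> *\<^sub>R z) \<partial>unif)"
      using integrable_smoothing[OF assms] by (simp add: uniform_smoothing_def)
    also have "\<dots> \<le> (\<integral>z. L * dist x y \<partial>(unif :: 'a measure))"
    proof (rule integral_mono)
      show "f (x + \<rho> *\<^sub>R z) - f (y + \<rho> *\<^sub>R z) \<le> L * dist x y" for z
        using lipschitz_onD[OF f, of "x + \<rho> *\<^sub>R z" "y + \<rho> *\<^sub>R z"] by (simp add: dist_real_def)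
    qed (auto intro: integrable_smoothing[OF assms])
    finally show ?thesis
      using prob_space by simp
  qed
  show "dist (uniform_smoothing f \<rho> x) (uniform_smoothing f \<rho> y) \<le> L * dist x y" for x y
    using le[of x y] le[of y x] by (simp add: dist_real_def dist_commute abs_le_iff)
  show "0 \<le> L"
    using f by (rule lipschitz_on_nonneg)
qed

text \<open>Differentiation under the integral, justified by Rademacher's theorem; the degenerate radius
  \<open>\<rho> = 0\<close> is separate because \<open>z \<mapsto> y + \<rho> z\<close> then does not preserve null sets.\<close>

lemma GDERIV_uniform_smoothing_ge:
  fixes f :: "'a::euclidean_space \<Rightarrow> real"
  assumes f: "L-lipschitz_on UNIV f" and \<rho>: "\<rho> \<ge> 0"
    and G: "GDERIV (uniform_smoothing f \<rho>) y :> G"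
    and b: "\<And>w s. w \<in> cball y \<rho> \<Longrightarrow> GDERIV f w :> s \<Longrightarrow> b \<le> u \<bullet> s"
  shows "b \<le> u \<bullet> G"
proof (cases "\<rho> = 0")
  case True
  then show ?thesis
    using b[of y G] G by (simp add: uniform_smoothing_0)
next
  case False
  interpret prob_space "unif :: 'a measure" by (rule prob_space_unif)
  define \<tau> where "\<tau> k = inverse (real (Suc k))" for k
  have \<tau>: "0 < \<tau> k" for k
    by (auto simp: \<tau>_def)
  have \<tau>_lim: "filterlim \<tau> (at_right 0) sequentially"
    unfolding \<tau>_def by (rule filterlim_inverse_Suc_at_right)
  note [measurable] = borel_measurable_dquot[OF f] borel_measurable_dir_deriv[OF f]
  have "AE z in lborel. \<exists>s. GDERIV f (y + \<rho> *\<^sub>R z) :> s"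
    using rademacher[OF f] False by (rule AE_lborel_affine)
  \<comment> \<open>Almost every \<open>y + \<rho> *\<^sub>R z\<close> is a point of
    differentiability, where \<open>dir_deriv\<close> is the inner product of \<open>u\<close> with
    the gradient; for \<open>z\<close> in the unit ball the hypothesis \<open>b\<close> bounds it
    from below.\<close>
  then have ae: "AE z in unif. b \<le> dir_deriv f u (y + \<rho> *\<^sub>R z) \<and>
      (\<lambda>k. dquot f u (\<tau> k) (y + \<rho> *\<^sub>R z)) \<longlonglongrightarrow> dir_deriv f u (y + \<rho> *\<^sub>R z)"
    unfolding AE_unif_iff
  proof eventually_elim
    case (elim z)
    then obtain s where s: "GDERIV f (y + \<rho> *\<^sub>R z) :> s" ..
    have lim: "(\<lambda>k. dquot f u (\<tau> k) (y + \<rho> *\<^sub>R z)) \<longlonglongrightarrow> u \<bullet> s"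
      using GDERIV_tendsto_dquot[OF s] \<tau>_lim by (rule filterlim_compose)
    then have "dir_deriv f u (y + \<rho> *\<^sub>R z) = u \<bullet> s"
      unfolding dir_deriv_def \<tau>_def by (rule limI)
    moreover have "y + \<rho> *\<^sub>R z \<in> cball y \<rho>" if "z \<in> cball 0 1"
      using that \<rho> by (auto simp: dist_norm intro: mult_left_le)
    ultimately show ?case
      using lim b[OF _ s] by auto
  qed
  have bound: "AE z in unif. norm (dquot f u (\<tau> k) (y + \<rho> *\<^sub>R z)) \<le> L * norm u" for k
    using dquot_bound[OF f \<tau>] by simp
  have lim: "AE z in unif. (\<lambda>k. dquot f u (\<tau> k) (y + \<rho> *\<^sub>R z)) \<longlonglongrightarrow> dir_deriv f u (y + \<rho> *\<^sub>R z)"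
    using ae by eventually_elim simp
  have meas: "(\<lambda>z. dir_deriv f u (y + \<rho> *\<^sub>R z)) \<in> borel_measurable unif"
    "(\<lambda>z. dquot f u (\<tau> k) (y + \<rho> *\<^sub>R z)) \<in> borel_measurable unif" for k
    by measurable
  note dom = meas integrable_const[of "L * norm u"] lim bound
  have "dquot (uniform_smoothing f \<rho>) u (\<tau> k) y = (\<integral>z. dquot f u (\<tau> k) (y + \<rho> *\<^sub>R z) \<partial>unif)" for k
  proof -
    have eq: "dquot f u (\<tau> k) (y + \<rho> *\<^sub>R z) = (f ((y + \<tau> k *\<^sub>R u) + \<rho> *\<^sub>R z) - f (y + \<rho> *\<^sub>R z)) / \<tau> k" for z
      by (simp add: dquot_def algebra_simps)
    show ?thesis
      unfolding eq dquot_def[of "uniform_smoothing f \<rho>"] uniform_smoothing_def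
      using integrable_smoothing[OF f \<rho>] by simp
  qed
  moreover have "(\<lambda>k. dquot (uniform_smoothing f \<rho>) u (\<tau> k) y) \<longlonglongrightarrow> u \<bullet> G"
    using GDERIV_tendsto_dquot[OF G] \<tau>_lim by (rule filterlim_compose)
  \<comment> \<open>Both sides are limits of the quotients of the smoothing: the left one by
    dominated convergence, the right one by differentiability at \<open>y\<close>.\<close>
  ultimately have "(\<integral>z. dir_deriv f u (y + \<rho> *\<^sub>R z) \<partial>unif) = u \<bullet> G"
    using integral_dominated_convergence[OF dom] LIMSEQ_unique by fastforce
  moreover have "b \<le> (\<integral>z. dir_deriv f u (y + \<rho> *\<^sub>R z) \<partial>unif)"
  proof -
    have "b = (\<integral>z. b \<partial>(unif :: 'a measure))"
      using prob_space by simp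
    also have "\<dots> \<le> (\<integral>z. dir_deriv f u (y + \<rho> *\<^sub>R z) \<partial>unif)"
      by (intro integral_mono_AE integrable_const integrable_dominated_convergence[OF dom])
        (use ae in eventually_elim, simp)
    finally show ?thesis .
  qed
  ultimately show ?thesis by simp
qed

text \<open>The right-hand side is convex, so it is enough to place limiting gradients in it. If one
  lay outside, a nearby gradient of the smoothing would violate the separating inequality, which
  averaging over a ball of radius \<open>\<rho>\<close> preserves.\<close>

lemma goldstein_subdifferential_smoothing_subset:
  fixes f :: "'a::euclidean_space \<Rightarrow> real"
  assumes f: "L-lipschitz_on UNIV f" and \<rho>: "\<rho> \<ge> 0"
  shows "goldstein_subdifferential \<nu> (uniform_smoothing f \<rho>) x \<subseteq> goldstein_subdifferential (\<rho> + \<nu>) f x"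
  unfolding goldstein_subdifferential_eq[of _ "uniform_smoothing f \<rho>"]
proof (rule hull_minimal)
  show "convex (goldstein_subdifferential (\<rho> + \<nu>) f x)"
    by (simp add: goldstein_subdifferential_def convex_convex_hull)
  show "limiting_gradients \<nu> (uniform_smoothing f \<rho>) x \<subseteq> goldstein_subdifferential (\<rho> + \<nu>) f x"
  proof (rule subsetI, rule ccontr)
    fix g assume "g \<in> limiting_gradients \<nu> (uniform_smoothing f \<rho>) x"
    then obtain w where w: "w \<in> cball x \<nu>" "(w, g) \<in> closure (gradient_graph (uniform_smoothing f \<rho>))"
      by (auto simp: limiting_gradients_def)
    assume "g \<notin> goldstein_subdifferential (\<rho> + \<nu>) f x"
    then obtain u b \<eta> where ub: "u \<bullet> g < b" "\<eta> > 0"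
      "\<And>w s. w \<in> cball x (\<rho> + \<nu> + \<eta>) \<Longrightarrow> GDERIV f w :> s \<Longrightarrow> b \<le> u \<bullet> s"
      by (rule goldstein_subdifferential_separation[OF f]) blast
    have "open (ball w \<eta> \<times> {g. u \<bullet> g < b})"
      by (intro open_Times open_ball open_halfspace_lt)
    moreover have "(w, g) \<in> ball w \<eta> \<times> {g. u \<bullet> g < b}"
      using ub by simp
    ultimately have "gradient_graph (uniform_smoothing f \<rho>) \<inter> (ball w \<eta> \<times> {g. u \<bullet> g < b}) \<noteq> {}"
      using w(2) unfolding closure_iff_nhds_not_empty by blast
    then obtain y G where y: "dist w y < \<eta>" "u \<bullet> G < b" "GDERIV (uniform_smoothing f \<rho>) y :> G"
      by (auto simp: gradient_graph_def)
    \<comment> \<open>The radii add up along the chain from \<open>x\<close> through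
      \<open>w\<close> and \<open>y\<close> to \<open>v\<close>: at most \<open>\<nu>\<close>, less
      than \<open>\<eta>\<close>, at most \<open>\<rho>\<close>.\<close>
    have "v \<in> cball x (\<rho> + \<nu> + \<eta>)" if "v \<in> cball y \<rho>" for v
      using that y(1) w(1) dist_triangle[of x v y] dist_triangle[of x y w] by simp
    then have "b \<le> u \<bullet> G"
      using ub(3) by (intro GDERIV_uniform_smoothing_ge[OF f \<rho> y(3)]) blast
    with y(2) show False by simp
  qed
qed

section \<open>Minimum-norm elements and stationarity\<close>

text \<open>\<open>ARG_MIN\<close> is a choice operator and is informative only once a minimizer
  exists; compactness and nonemptiness provide one.\<close>

lemma goldstein_min_norm:
  fixes f :: "'a::euclidean_space \<Rightarrow> real"
  assumes f: "L-lipschitz_on UNIV f" and "\<delta> \<ge> 0"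
  shows "goldstein_min_norm \<delta> f x \<in> goldstein_subdifferential \<delta> f x"
    and "g \<in> goldstein_subdifferential \<delta> f x \<Longrightarrow> norm (goldstein_min_norm \<delta> f x) \<le> norm g"
proof -
  obtain m where m: "m \<in> goldstein_subdifferential \<delta> f x"
    "\<And>g. g \<in> goldstein_subdifferential \<delta> f x \<Longrightarrow> norm m \<le> norm g"
    using continuous_attains_inf[OF compact_goldstein_subdifferential[OF f]
        goldstein_subdifferential_nonempty[OF assms] continuous_on_norm_id]
    by blast
  have "is_arg_min norm (\<lambda>g. g \<in> goldstein_subdifferential \<delta> f x) m"
    using m by (auto simp: is_arg_min_linorder)
  then have "is_arg_min norm (\<lambda>g. g \<in> goldstein_subdifferential \<delta> f x) (goldstein_min_norm \<delta> f x)"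
    unfolding goldstein_min_norm_def arg_min_def by (rule someI)
  then show "goldstein_min_norm \<delta> f x \<in> goldstein_subdifferential \<delta> f x"
    "g \<in> goldstein_subdifferential \<delta> f x \<Longrightarrow> norm (goldstein_min_norm \<delta> f x) \<le> norm g"
    by (auto simp: is_arg_min_linorder)
qed

text \<open>The minimizer over the smaller set competes in the larger one. Both functions are taken
  Lipschitz so that both minima are attained.\<close>

lemma goldstein_stationary_if_subset:
  fixes f h :: "'a::euclidean_space \<Rightarrow> real"
  assumes "L-lipschitz_on UNIV f" "M-lipschitz_on UNIV h" "\<delta> \<ge> 0" "\<nu> \<ge> 0"
    and "goldstein_subdifferential \<nu> h x \<subseteq> goldstein_subdifferential \<delta> f x"
    and "goldstein_stationary \<nu> \<epsilon> h x"
  shows "goldstein_stationary \<delta> \<epsilon> f x"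
  using goldstein_min_norm(2)[OF assms(1,3)] goldstein_min_norm(1)[OF assms(2,4)] assms(5,6)
  unfolding goldstein_stationary_def by (meson order_trans subsetD)

theorem lemma4:
  fixes f :: "real ^ 'd \<Rightarrow> real" and \<rho> \<nu> :: real and x :: "real ^ 'd"
  assumes "\<exists>L. L-lipschitz_on UNIV f"
    and "\<rho> \<ge> 0" and "\<nu> \<ge> 0"
  shows "goldstein_subdifferential \<nu> (uniform_smoothing f \<rho>) x
           \<subseteq> goldstein_subdifferential (\<rho> + \<nu>) f x
    \<and> (\<forall>\<epsilon>. goldstein_stationary \<nu> \<epsilon> (uniform_smoothing f \<rho>) x \<longrightarrow>
            goldstein_stationary (\<rho> + \<nu>) \<epsilon> f x)
    \<and> (\<forall>\<epsilon> \<delta>. \<rho> + \<nu> \<le> \<delta> \<longrightarrow> goldstein_stationary \<nu> \<epsilon> (uniform_smoothing f \<rho>) x \<longrightarrow>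
            goldstein_stationary \<delta> \<epsilon> f x)"
proof -
  obtain L where L: "L-lipschitz_on UNIV f"
    using assms(1) ..
  note L' = lipschitz_on_uniform_smoothing[OF L assms(2)]
  \<comment> \<open>A general \<open>\<delta>\<close> treats all claims at once; the first two are
    the case \<open>\<delta> = \<rho> + \<nu>\<close>.\<close>
  have sub: "goldstein_subdifferential \<nu> (uniform_smoothing f \<rho>) x \<subseteq> goldstein_subdifferential \<delta> f x"
    if "\<rho> + \<nu> \<le> \<delta>" for \<delta>
    using goldstein_subdifferential_smoothing_subset[OF L assms(2)] goldstein_subdifferential_mono[OF that]
    by blast
  have "goldstein_stationary \<delta> \<epsilon> f x"
    if "\<rho> + \<nu> \<le> \<delta>" "goldstein_stationary \<nu> \<epsilon> (uniform_smoothing f \<rho>) x" for \<epsilon> \<delta>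
    using that assms(2,3) by (intro goldstein_stationary_if_subset[OF L L' _ _ sub]) auto
  with sub show ?thesis
    by blast
qed

end
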